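(* Let $G(V,E,w)$ be a simple connected vertex-weighted graph with at least two vertices of degree $1$. Then $G$ is star-convex if and only if there exists a subgraph $T\subseteq G$ that is a tree, is star-convex (with the weight function given by the restriction of $w$ to the vertices of $T$), and satisfies $V_{\ell}(G)=V_{\ell}(T)$.
   Context: All graphs are finite. A weighted graph $G(V,E,w)$ is a simple connected graph with vertex set $V$, edge set $E$ and a vertex-weight function $w:V\to\mathbb{R}_{+}$, where $\mathbb{R}_+$ is the set of non-negative reals. For a graph $H$, $V_{\ell}(H)$ denotes the set of vertices of $H$ whose degree in $H$ is exactly $1$ (leaf vertices). A path $x_0,x_1,\dots,x_k$ is weighted-monotone if $w(x_0)\le w(x_1)\le\cdots\le w(x_k)$ or $w(x_0)\ge w(x_1)\ge\cdots\ge w(x_k)$ (a one-vertex path is trivially weighted-monotone). A weighted graph with non-empty $V_{\ell}$ is star-convex if there exists a vertex $u\in V$ such that for every $v\in V_{\ell}$ there is a weighted-monotone path in the graph connecting $u$ and $v$. *)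

theory Defs
  imports "Graph_Theory.Graph_Theory" "HOL-Library.FuncSet"
begin

text \<open>
  Following the AFP graph library, a finite simple graph is a finite loop-free symmetric
  digraph (locale \<open>pair_graph\<close>): an undirected edge is represented by the two arcs
  \<open>(x, y)\<close> and \<open>(y, x)\<close>. A subgraph in the undirected sense is therefore a \<open>subgraph\<close>
  that is itself a \<open>pair_graph\<close>.
\<close>

definition weighted_graph :: "'a pair_pre_digraph \<Rightarrow> ('a \<Rightarrow> real) \<Rightarrow> bool" where
  "weighted_graph G w \<longleftrightarrow>
     pair_graph G \<and> Digraph_Component.connected (with_proj G) \<and> (\<forall>v \<in> pverts G. 0 \<le> w v)"

text \<open>
  The degree of a vertex in the undirected sense is its out-degree in the symmetric digraph.
\<close>

definition leaves :: "'a pair_pre_digraph \<Rightarrow> 'a set" where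
  "leaves H = {v \<in> pverts H. out_degree (with_proj H) v = 1}"

text \<open>
  The library's \<open>tree\<close> cannot be used for symmetric digraphs: it forbids all directed cycles,
  and the closed walk \<open>x, y, x\<close> along a single undirected edge is one of them.
  In a simple symmetric digraph, the directed cycles with at least three arcs are exactly the
  cycles of the undirected graph.
\<close>

definition graph_tree :: "'a pair_pre_digraph \<Rightarrow> bool" where
  "graph_tree T \<longleftrightarrow>
     pair_graph T \<and> Digraph_Component.connected (with_proj T) \<and>
     \<not> (\<exists>p. pre_digraph.cycle (with_proj T) p \<and> 3 \<le> length p)"

definition weighted_monotone :: "('a \<Rightarrow> real) \<Rightarrow> 'a list \<Rightarrow> bool" where
  "weighted_monotone w p \<longleftrightarrow> sorted_wrt (\<le>) (map w p) \<or> sorted_wrt (\<ge>) (map w p)"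

definition star_convex :: "'a pair_pre_digraph \<Rightarrow> ('a \<Rightarrow> real) \<Rightarrow> bool" where
  "star_convex G w \<longleftrightarrow>
     weighted_graph G w \<and> leaves G \<noteq> {} \<and>
     (\<exists>u \<in> pverts G. \<forall>v \<in> leaves G.
        \<exists>p. vpath p (with_proj G) \<and> hd p = u \<and> last p = v \<and> weighted_monotone w p)"

end

theory Submission
  imports Defs
begin

text \<open>
  The direction from the tree to the graph holds because every path of \<open>T\<close> is a path of \<open>G\<close> and
  both have the same leaves.

  For the converse, let \<open>r\<close> be a centre of \<open>G\<close> and call an arc \<open>(x, y)\<close> \<^emph>\<open>forward\<close> if
  \<open>w r \<le> w x \<le> w y\<close> or \<open>w r \<ge> w x \<ge> w y\<close>. A walk from \<open>r\<close> is weighted-monotone exactly if all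
  its arcs are forward: once the weight has left the value \<open>w r\<close> in one direction, a forward arc
  cannot turn back. So star-convexity says that every leaf is reachable from \<open>r\<close> in a digraph, and a
  digraph has a shortest-path tree: choose for every reachable vertex a forward arc
  from a vertex nearer to \<open>r\<close> (lemma \<open>breadth_first_parents\<close>). The leaves of that tree need not be
  leaves of \<open>G\<close>. Therefore take, over all possible roots, a tree of this kind that contains all
  leaves of \<open>G\<close> and has as few vertices as possible. A childless vertex other than the root is a leaf
  of \<open>G\<close>, since it could otherwise be dropped. A root with only one child is a leaf of \<open>G\<close> as well,
  since otherwise it could be dropped and its child made the new centre
  (lemma \<open>remove_root\<close>). Conversely a leaf of \<open>G\<close> in the tree has degree one there, because
  degrees do not increase in a subgraph and a tree with two vertices has no isolated one.
\<close>

section \<open>Trees given by parent pointers\<close>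

lemma tl_pawalk_verts: "pcas u p v \<Longrightarrow> tl (pawalk_verts u p) = map snd p"
proof (induction p arbitrary: u)
  case (Cons e p)
  then show ?case by (cases p) auto
qed simp

text \<open>
  The rank \<open>h\<close> decreases along parent pointers, which rules out cycles of pointers; any such
  rank will do, so that vertices may be deleted without recomputing depths.
\<close>
locale rooted_parents =
  fixes V :: "'a set" and r :: 'a and par :: "'a \<Rightarrow> 'a" and h :: "'a \<Rightarrow> nat"
  assumes finite_verts: "finite V"
    and root_in: "r \<in> V"
    and par_in: "\<lbrakk>x \<in> V; x \<noteq> r\<rbrakk> \<Longrightarrow> par x \<in> V"
    and par_less: "\<lbrakk>x \<in> V; x \<noteq> r\<rbrakk> \<Longrightarrow> h (par x) < h x"
begin

definition parent_graph :: "'a pair_pre_digraph" where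
  "parent_graph = \<lparr> pverts = V,
     parcs = (\<lambda>x. (par x, x)) ` (V - {r}) \<union> (\<lambda>x. (x, par x)) ` (V - {r}) \<rparr>"

definition children :: "'a \<Rightarrow> 'a set" where
  "children x = {c \<in> V - {r}. par c = x}"

lemma pverts_parent_graph [simp]: "pverts parent_graph = V"
  by (simp add: parent_graph_def)

lemma parcs_parent_graph:
  "(x, y) \<in> parcs parent_graph \<longleftrightarrow>
     y \<in> V \<and> y \<noteq> r \<and> x = par y \<or> x \<in> V \<and> x \<noteq> r \<and> y = par x"
  by (auto simp: parent_graph_def)

lemma pair_graph_parent_graph: "pair_graph parent_graph"
proof
  show "finite (pverts parent_graph)" "finite (parcs parent_graph)"
    using finite_verts by (auto simp: parent_graph_def)
  show "symmetric (with_proj parent_graph)"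
    by (auto simp: symmetric_def sym_def parcs_parent_graph)
  fix e assume e: "e \<in> parcs parent_graph"
  show "fst e \<in> pverts parent_graph" "snd e \<in> pverts parent_graph"
    using e by (cases e; auto simp: parcs_parent_graph par_in)+
  show "fst e \<noteq> snd e"
    using e par_less by (cases e) (force simp: parcs_parent_graph)
qed

lemma parent_induct [consumes 1, case_names base step]:
  assumes "x \<in> V" "P r" "\<And>x. \<lbrakk>x \<in> V; x \<noteq> r; P (par x)\<rbrakk> \<Longrightarrow> P x"
  shows "P x"
  using assms(1)
proof (induction "h x" arbitrary: x rule: less_induct)
  case less
  show ?case
    using less assms(2,3) par_in par_less by (cases "x = r") auto
qed

lemma connected_parent_graph: "Digraph_Component.connected (with_proj parent_graph)"
proof -
  interpret T: pair_graph parent_graph by (rule pair_graph_parent_graph)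
  have "r \<rightarrow>\<^sup>*\<^bsub>with_proj parent_graph\<^esub> x" if "x \<in> V" for x
    using that
  proof (induction rule: parent_induct)
    case base
    show ?case using root_in by (simp add: T.reachable_refl)
  next
    case (step x)
    then have "(par x, x) \<in> parcs parent_graph" by (simp add: parcs_parent_graph)
    with step.IH show ?case by (metis T.reachable_adj_trans with_proj_simps(3))
  qed
  moreover from this have "x \<rightarrow>\<^sup>*\<^bsub>with_proj parent_graph\<^esub> r" if "x \<in> V" for x
    using that symmetric_reachable[OF T.sym_arcs] by blast
  ultimately have "strongly_connected (with_proj parent_graph)"
    unfolding strongly_connected_def with_proj_simps pverts_parent_graph
    using root_in T.reachable_trans by blast
  moreover have "mk_symmetric (with_proj parent_graph) = parent_graph"
    using T.adj_mk_symmetric_eq[OF T.sym_arcs]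
    by (intro pair_pre_digraph.equality) (simp_all add: parent_graph_def)
  ultimately show ?thesis by (simp add: Digraph_Component.connected_def)
qed

text \<open>
  On a cycle, both neighbours of a vertex of maximal rank have smaller rank, hence both equal
  its parent.
\<close>
lemma no_long_cycle:
  assumes "pre_digraph.cycle (with_proj parent_graph) p" "3 \<le> length p"
  shows False
proof -
  interpret T: pair_graph parent_graph by (rule pair_graph_parent_graph)
  obtain u where u: "T.awalk u p u" "distinct (tl (pawalk_verts u p))"
    using assms(1) by (auto simp: T.cycle_def)
  then have dist: "distinct (map snd p)"
    using tl_pawalk_verts[of u p u] by (auto simp: T.awalk_def)
  let ?S = "set (pawalk_verts u p)"
  have fin: "finite (h ` ?S)" and ne: "h ` ?S \<noteq> {}" by (cases p; simp)+
  obtain m where m: "m \<in> ?S" and "h m = Max (h ` ?S)"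
    using Max_in[OF fin ne] by (metis imageE)
  then have max: "h x \<le> h m" if "x \<in> ?S" for x
    using that by simp
  obtain q s where qs: "p = q @ s" "T.awalk m (s @ q) m"
    and same: "set (pawalk_verts m (s @ q)) = set (pawalk_verts u p)"
    using T.rotate_awalkE[OF u(1) m] by metis
  \<comment> \<open>The cycle read from \<open>m\<close>: it leaves for \<open>b\<close> and comes back from \<open>a\<close>. Having at least
    three arcs, it meets \<open>a\<close> and \<open>b\<close> as the ends of two different arcs.\<close>
  define c where "c = s @ q"
  have "length c \<ge> 3" "distinct (map snd c)" "T.awalk m c m"
    using assms(2) dist qs by (auto simp: c_def)
  then obtain b d c' where c: "c = (m, b) # d # c'" "c' \<noteq> []"
    by (auto simp: T.awalk_def numeral_3_eq_3 Suc_le_length_iff)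
  then obtain c'' a z where c'': "c' = c'' @ [(a, z)]"
    by (cases c' rule: rev_cases) auto
  have arcs: "(m, b) \<in> parcs parent_graph" "(a, z) \<in> parcs parent_graph"
    using \<open>T.awalk m c m\<close> by (auto simp: T.awalk_def c c'')
  have walk: "pcas b ((d # c'') @ [(a, z)]) m"
    using \<open>T.awalk m c m\<close> by (auto simp: T.awalk_def c c'')
  then have "z = m" and a: "a = snd (last (d # c''))"
  proof -
    have "pcas v (l @ [(a, z)]) m \<Longrightarrow> z = m \<and> (l \<noteq> [] \<longrightarrow> a = snd (last l))" for l v
      by (induction l arbitrary: v) auto
    from this[OF walk] show "z = m" "a = snd (last (d # c''))" by auto
  qed
  have "a \<in> snd ` set (d # c'')"
    using a last_in_set[of "d # c''"] by auto
  then have "a \<noteq> b" using \<open>distinct (map snd c)\<close> by (auto simp: c c'')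
  have "{b, a} \<subseteq> snd ` set c"
    using \<open>a \<in> _\<close> by (auto simp: c c'')
  also have "snd ` set c \<subseteq> set (pawalk_verts m c)"
    using tl_pawalk_verts[of m c m] \<open>T.awalk m c m\<close>
    by (metis T.awalk_def list.set_map list.set_sel(2) list.sel(2) subsetI)
  finally have "h a \<le> h m" "h b \<le> h m" using max same c_def by auto
  with arcs \<open>z = m\<close> have "b = par m" "a = par m"
    using par_less by (auto simp: parcs_parent_graph) (metis not_less)+
  with \<open>a \<noteq> b\<close> show False by simp
qed

lemma graph_tree_parent_graph: "graph_tree parent_graph"
  using pair_graph_parent_graph connected_parent_graph no_long_cycle
  by (auto simp: graph_tree_def)

lemma out_degree_parent_graph:
  assumes "x \<in> V"
  shows "out_degree (with_proj parent_graph) x = card (children x) + (if x = r then 0 else 1)"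
proof -
  have fin: "finite (children x)" using finite_verts by (auto simp: children_def)
  have notin: "par x \<notin> children x" if "x \<noteq> r"
    using that assms par_less[of x] par_less[of "par x"] by (auto simp: children_def)
  define N where "N = (if x = r then {} else {par x})"
  have N: "y \<in> N \<longleftrightarrow> x \<noteq> r \<and> y = par x" for y
    by (simp add: N_def)
  have arcs: "(x, y) \<in> parcs parent_graph \<longleftrightarrow> y \<in> children x \<or> y \<in> N" for y
    unfolding parcs_parent_graph children_def N using assms by blast
  have "out_arcs (with_proj parent_graph) x = Pair x ` (children x \<union> N)"
    unfolding out_arcs_def with_proj_simps using arcs by force
  then have "out_degree (with_proj parent_graph) x = card (children x \<union> N)"
    by (simp add: out_degree_def card_image inj_on_def)
  also have "\<dots> = card (children x) + card N"
    using fin notin N by (intro card_Un_disjoint) (auto simp: N_def)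
  finally show ?thesis by (simp add: N_def)
qed

lemma root_has_child:
  assumes "V \<noteq> {r}"
  shows "children r \<noteq> {}"
proof
  assume none: "children r = {}"
  have "x = r" if "x \<in> V" for x
    using that
  proof (induction rule: parent_induct)
    case (step x)
    then have "x \<in> children r" by (simp add: children_def)
    then show ?case unfolding none by (rule emptyE)
  qed simp
  then have "V = {r}" using root_in by blast
  with assms show False by contradiction
qed

text \<open>A vertex without children is nobody's parent, so the pointers stay inside what remains.\<close>
lemma remove_childless:
  assumes "x \<noteq> r" "children x = {}"
  shows "rooted_parents (V - {x}) r par h"
  using assms finite_verts root_in par_in par_less
  by unfold_locales (auto simp: children_def)

end

section \<open>Weighted-monotone trees\<close>

text \<open>
  All arcs are forward with respect to the root. This local condition replaces monotonicity of
  the paths from the root.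
\<close>
locale monotone_tree = rooted_parents V r par h
  for V :: "'a set" and r par h +
  fixes E :: "'a rel" and w :: "'a \<Rightarrow> real"
  assumes arc: "\<lbrakk>x \<in> V; x \<noteq> r\<rbrakk> \<Longrightarrow> (par x, x) \<in> E"
    and forward: "\<lbrakk>x \<in> V; x \<noteq> r\<rbrakk> \<Longrightarrow>
      w r \<le> w (par x) \<and> w (par x) \<le> w x \<or> w x \<le> w (par x) \<and> w (par x) \<le> w r"
begin

text \<open>
  The path grows by one vertex at each induction step. The ranks along it increase, which makes
  it a path; the direction of monotonicity is read off from its end, so that a path of constant
  weight can still be continued either way.
\<close>
lemma monotone_path_from_root:
  assumes "x \<in> V"
  shows "\<exists>p. vpath p (with_proj parent_graph) \<and> hd p = r \<and> last p = x \<and> weighted_monotone w p"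
proof -
  have "\<exists>p. vwalk p (with_proj parent_graph) \<and> hd p = r \<and> last p = x
      \<and> (\<forall>y\<in>set p. h y \<le> h x) \<and> distinct p
      \<and> (w r \<le> w x \<longrightarrow> sorted_wrt (\<le>) (map w p) \<and> (\<forall>y\<in>set p. w y \<le> w x))
      \<and> (w x \<le> w r \<longrightarrow> sorted_wrt (\<ge>) (map w p) \<and> (\<forall>y\<in>set p. w x \<le> w y))"
    using assms
  proof (induction rule: parent_induct)
    case base
    show ?case using root_in by (intro exI[of _ "[r]"]) (auto simp: vwalk_def)
  next
    case (step x)
    then obtain p where p: "vwalk p (with_proj parent_graph)" "hd p = r" "last p = par x"
      "\<forall>y\<in>set p. h y \<le> h (par x)" "distinct p"
      and up: "w r \<le> w (par x) \<Longrightarrow> sorted_wrt (\<le>) (map w p) \<and> (\<forall>y\<in>set p. w y \<le> w (par x))"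
      and down: "w (par x) \<le> w r \<Longrightarrow> sorted_wrt (\<ge>) (map w p) \<and> (\<forall>y\<in>set p. w (par x) \<le> w y)"
      by auto
    have "p \<noteq> []" using p(1) by (auto simp: vwalk_def)
    have rank: "\<forall>y\<in>set p. h y < h x" using p(4) par_less step.hyps by fastforce
    have "vwalk (p @ [x]) (with_proj parent_graph)"
      using p(1,3) step.hyps \<open>p \<noteq> []\<close>
      by (auto simp: vwalk_def vwalk_arcs_append parcs_parent_graph)
    moreover have "sorted_wrt (\<le>) (map w (p @ [x])) \<and> (\<forall>y\<in>set (p @ [x]). w y \<le> w x)"
      if "w r \<le> w x"
    proof -
      have "w r \<le> w (par x)" "w (par x) \<le> w x"
        using forward[OF step.hyps] that by linarith+
      with up show ?thesis by (fastforce simp: sorted_wrt_append)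
    qed
    moreover have "sorted_wrt (\<ge>) (map w (p @ [x])) \<and> (\<forall>y\<in>set (p @ [x]). w x \<le> w y)"
      if "w x \<le> w r"
    proof -
      have "w (par x) \<le> w r" "w x \<le> w (par x)"
        using forward[OF step.hyps] that by linarith+
      with down show ?thesis by (fastforce simp: sorted_wrt_append)
    qed
    ultimately show ?case
      using p(2,5) rank \<open>p \<noteq> []\<close> by (intro exI[of _ "p @ [x]"]) (auto simp: less_imp_le)
  qed
  then obtain p where p: "vwalk p (with_proj parent_graph)" "hd p = r" "last p = x" "distinct p"
    and "w r \<le> w x \<longrightarrow> sorted_wrt (\<le>) (map w p)" "w x \<le> w r \<longrightarrow> sorted_wrt (\<ge>) (map w p)"
    by blast
  then have "weighted_monotone w p" unfolding weighted_monotone_def by (meson linear)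
  with p show ?thesis unfolding vpath_def by blast
qed

lemma remove_childless_monotone:
  assumes "x \<noteq> r" "children x = {}"
  shows "monotone_tree (V - {x}) r par h E w"
  using remove_childless[OF assms] arc forward
  by (simp add: monotone_tree_def monotone_tree_axioms_def)

text \<open>
  Every path from the root to another vertex passes through the only child \<open>c\<close>, so the weight
  of \<open>c\<close> lies between that of the root and that of any later vertex; an arc that is forward with
  respect to the root is then forward with respect to \<open>c\<close>.
\<close>
lemma remove_root:
  assumes "children r = {c}"
  shows "monotone_tree (V - {r}) c par h E w"
proof -
  have c: "c \<in> V" "c \<noteq> r" "par c = r"
    using assms by (auto simp: children_def)
  have not_root: "par x \<noteq> r" if "x \<in> V" "x \<noteq> r" "x \<noteq> c" for x
    using that assms by (auto simp: children_def)
  have between: "x \<noteq> r \<longrightarrow> w r \<le> w c \<and> w c \<le> w x \<or> w x \<le> w c \<and> w c \<le> w r" if "x \<in> V" for x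
    using that
  proof (induction rule: parent_induct)
    case (step x)
    show ?case
    proof (cases "x = c")
      case True
      then show ?thesis using forward[OF c(1,2)] c(3) by auto
    next
      case False
      with step not_root forward[OF step.hyps] show ?thesis by fastforce
    qed
  qed simp
  show ?thesis
  proof
    show "finite (V - {r})" "c \<in> V - {r}" using finite_verts c by auto
    fix x assume x: "x \<in> V - {r}" "x \<noteq> c"
    then show "par x \<in> V - {r}" "h (par x) < h x" "(par x, x) \<in> E"
      using par_in par_less arc not_root by auto
    have "par x \<in> V" "par x \<noteq> r" using x par_in not_root by auto
    with between[of "par x"] forward[of x] x
    show "w c \<le> w (par x) \<and> w (par x) \<le> w x \<or> w x \<le> w (par x) \<and> w (par x) \<le> w c"
      by fastforce
  qed
qed

end

section \<open>Existence of a shortest-path tree\<close>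

lemma monotone_walk_reachable:
  assumes "p \<noteq> []" "set (vwalk_arcs p) \<subseteq> E" "sorted_wrt R (map w p)" "R (w r) (w (hd p))"
    and "transp R"
  shows "(hd p, last p) \<in> {(x, y) \<in> E. R (w r) (w x) \<and> R (w x) (w y)}\<^sup>*"
  using assms
proof (induction p rule: vwalk_arcs.induct)
  case (3 x y p)
  have xy: "R (w x) (w y)" "R (w r) (w x)" using 3 by auto
  then have "R (w r) (w y)" using \<open>transp R\<close> by (blast dest: transpD)
  with 3 have "(y, last (y # p)) \<in> {(x, y) \<in> E. R (w r) (w x) \<and> R (w x) (w y)}\<^sup>*"
    by simp
  moreover have "(x, y) \<in> {(x, y) \<in> E. R (w r) (w x) \<and> R (w x) (w y)}"
    using xy 3 by simp
  ultimately have "(x, last (y # p)) \<in> {(x, y) \<in> E. R (w r) (w x) \<and> R (w x) (w y)}\<^sup>*"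
    by (rule converse_rtrancl_into_rtrancl[rotated])
  then show ?case by simp
qed auto

text \<open>The rank is the distance from the root.\<close>
lemma breadth_first_parents:
  fixes D :: "'a rel"
  obtains par h where
    "\<And>x. \<lbrakk>(r, x) \<in> D\<^sup>*; x \<noteq> r\<rbrakk> \<Longrightarrow> (r, par x) \<in> D\<^sup>* \<and> (par x, x) \<in> D \<and> h (par x) < (h x :: nat)"
proof -
  define h where "h x = (LEAST n. (r, x) \<in> D ^^ n)" for x
  have ex: "\<exists>y. (r, y) \<in> D\<^sup>* \<and> (y, x) \<in> D \<and> h y < h x" if x: "(r, x) \<in> D\<^sup>*" "x \<noteq> r" for x
  proof -
    have hx: "(r, x) \<in> D ^^ h x"
      unfolding h_def using x(1) by (metis LeastI rtrancl_power)
    obtain n where n: "h x = Suc n"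
      using hx x(2) by (cases "h x") auto
    then obtain y where y: "(r, y) \<in> D ^^ n" "(y, x) \<in> D" using hx by auto
    have "h y \<le> n" unfolding h_def using y(1) by (rule Least_le)
    with n y show ?thesis by (metis le_imp_less_Suc relpow_imp_rtrancl)
  qed
  then have "\<exists>par. \<forall>x. (r, x) \<in> D\<^sup>* \<longrightarrow> x \<noteq> r \<longrightarrow>
      (r, par x) \<in> D\<^sup>* \<and> (par x, x) \<in> D \<and> h (par x) < h x"
    by metis
  then show thesis using that by blast
qed

lemma star_convex_imp_monotone_tree:
  assumes "star_convex G w"
  shows "\<exists>V r par h. monotone_tree V r par h (parcs G) w \<and> V \<subseteq> pverts G \<and> leaves G \<subseteq> V"
proof -
  interpret G: pair_graph G
    using assms by (simp add: star_convex_def weighted_graph_def)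
  obtain r where r: "r \<in> pverts G"
    and paths: "\<And>v. v \<in> leaves G \<Longrightarrow>
      \<exists>p. vpath p (with_proj G) \<and> hd p = r \<and> last p = v \<and> weighted_monotone w p"
    using assms by (auto simp: star_convex_def)
  define D where "D = {(x, y) \<in> parcs G. w r \<le> w x \<and> w x \<le> w y}
    \<union> {(x, y) \<in> parcs G. w r \<ge> w x \<and> w x \<ge> w y}"
  define V where "V = {x. (r, x) \<in> D\<^sup>*}"
  obtain par h where par: "\<And>x. \<lbrakk>(r, x) \<in> D\<^sup>*; x \<noteq> r\<rbrakk> \<Longrightarrow>
      (r, par x) \<in> D\<^sup>* \<and> (par x, x) \<in> D \<and> h (par x) < (h x :: nat)"
    by (rule breadth_first_parents[of r D]) blast
  have sub: "V \<subseteq> pverts G"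
  proof
    fix x assume "x \<in> V"
    then have "(r, x) \<in> D\<^sup>*" by (simp add: V_def)
    then show "x \<in> pverts G"
      using r by (induction) (auto simp: D_def dest: G.in_arcsD2)
  qed
  have "v \<in> V" if v: "v \<in> leaves G" for v
  proof -
    obtain p where p: "vpath p (with_proj G)" "hd p = r" "last p = v" "weighted_monotone w p"
      using paths[OF v] by auto
    then have p': "p \<noteq> []" "set (vwalk_arcs p) \<subseteq> parcs G" by (auto simp: vpath_def vwalk_def)
    from p(4) have "(r, v) \<in> {(x, y) \<in> parcs G. w r \<le> w x \<and> w x \<le> w y}\<^sup>*
        \<or> (r, v) \<in> {(x, y) \<in> parcs G. w r \<ge> w x \<and> w x \<ge> w y}\<^sup>*"
      using monotone_walk_reachable[OF p', of "(\<le>)" w r]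
        monotone_walk_reachable[OF p', of "(\<ge>)" w r] p(2,3)
      by (auto simp: weighted_monotone_def)
    then show ?thesis
      unfolding V_def D_def by (auto elim: rtrancl_mono[THEN subsetD, rotated])
  qed
  moreover have "monotone_tree V r par h (parcs G) w"
  proof
    show "finite V" using sub G.pair_finite_verts by (rule finite_subset)
    show "r \<in> V" by (simp add: V_def)
    fix x assume "x \<in> V" "x \<noteq> r"
    then have "par x \<in> V" "(par x, x) \<in> D" "h (par x) < h x"
      using par[of x] by (auto simp: V_def)
    then show "par x \<in> V" "h (par x) < h x" "(par x, x) \<in> parcs G"
      "w r \<le> w (par x) \<and> w (par x) \<le> w x \<or> w x \<le> w (par x) \<and> w (par x) \<le> w r"
      by (auto simp: D_def)
  qed
  ultimately show ?thesis using sub by blast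
qed

section \<open>The equivalence\<close>

lemma out_degree_subgraph_le:
  assumes "subgraph (with_proj T) (with_proj G)" "finite (parcs G)"
  shows "out_degree (with_proj T) x \<le> out_degree (with_proj G) x"
  unfolding out_degree_def out_arcs_def using assms
  by (intro card_mono) (auto simp: subgraph_def)

lemma weighted_monotone_restrict:
  assumes "set p \<subseteq> A"
  shows "weighted_monotone (restrict w A) p \<longleftrightarrow> weighted_monotone w p"
proof -
  have "map (restrict w A) p = map w p" using assms by (intro map_cong) auto
  then show ?thesis by (simp only: weighted_monotone_def)
qed

lemma star_convex_subtree_exists:
  assumes convex: "star_convex G w" and two: "2 \<le> card (leaves G)"
  obtains T where "subgraph (with_proj T) (with_proj G)" "graph_tree T"
    "star_convex T (restrict w (pverts T))" "leaves G = leaves T"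
proof -
  interpret G: pair_graph G
    using convex by (simp add: star_convex_def weighted_graph_def)
  define P where "P V \<longleftrightarrow> (\<exists>r par h. monotone_tree V r par h (parcs G) w)
    \<and> V \<subseteq> pverts G \<and> leaves G \<subseteq> V" for V
  obtain V where "P V" and least: "\<And>V'. P V' \<Longrightarrow> card V \<le> card V'"
    using star_convex_imp_monotone_tree[OF convex] ex_has_least_nat[of P _ card]
    unfolding P_def by metis
  then obtain r par h where tree: "monotone_tree V r par h (parcs G) w"
    and sub: "V \<subseteq> pverts G" and leaves_in: "leaves G \<subseteq> V"
    unfolding P_def by blast
  interpret monotone_tree V r par h "parcs G" w by (rule tree)
  let ?T = "with_proj parent_graph"
  interpret T: pair_graph parent_graph by (rule pair_graph_parent_graph)
  have subgraph: "subgraph ?T (with_proj G)"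
    unfolding subgraph_def compatible_def
    using sub arc G.arcs_symmetric T.wf_digraph G.wf_digraph
    by (auto simp: parcs_parent_graph)
  have minimal: "\<not> P (V - {x})" if "x \<in> V" for x
    using least[of "V - {x}"] finite_verts card_Diff1_less[OF finite_verts that] by auto
  have "V \<noteq> {r}"
    using two card_mono[OF finite_verts leaves_in] by auto
  have degree_pos: "1 \<le> out_degree ?T x" if "x \<in> V" for x
  proof -
    have "finite (children r)" using finite_verts by (simp add: children_def)
    with that root_has_child[OF \<open>V \<noteq> {r}\<close>] show ?thesis
      by (auto simp: out_degree_parent_graph Suc_le_eq card_gt_0_iff)
  qed
  have same_leaves: "leaves parent_graph = leaves G"
  proof
    show "leaves G \<subseteq> leaves parent_graph"
    proof
      fix x assume x: "x \<in> leaves G"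
      then have "out_degree ?T x \<le> 1"
        using out_degree_subgraph_le[OF subgraph G.pair_finite_arcs, of x]
        by (simp add: leaves_def)
      with degree_pos[of x] x leaves_in show "x \<in> leaves parent_graph"
        by (auto simp: leaves_def)
    qed
    show "leaves parent_graph \<subseteq> leaves G"
    proof (rule subsetI, rule ccontr)
      fix x assume "x \<in> leaves parent_graph" and notin: "x \<notin> leaves G"
      then have x: "x \<in> V" "out_degree ?T x = 1" by (auto simp: leaves_def)
      have "\<exists>r. monotone_tree (V - {x}) r par h (parcs G) w"
      proof (cases "x = r")
        case True
        with x obtain c where "children r = {c}"
          by (auto simp: out_degree_parent_graph card_1_singleton_iff)
        with remove_root True show ?thesis by blast
      next
        case False
        have "finite (children x)" using finite_verts by (simp add: children_def)
        with x False have "children x = {}" by (simp add: out_degree_parent_graph)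
        with remove_childless_monotone False show ?thesis by blast
      qed
      with sub leaves_in notin have "P (V - {x})" unfolding P_def by blast
      with minimal x(1) show False by blast
    qed
  qed
  have "star_convex parent_graph (restrict w V)"
    unfolding star_convex_def weighted_graph_def
  proof (intro conjI)
    show "pair_graph parent_graph" ..
    show "Digraph_Component.connected ?T" by (rule connected_parent_graph)
    show "\<forall>v\<in>pverts parent_graph. 0 \<le> restrict w V v"
      using convex sub by (auto simp: star_convex_def weighted_graph_def)
    show "leaves parent_graph \<noteq> {}" using two same_leaves by auto
    have "\<exists>p. vpath p ?T \<and> hd p = r \<and> last p = v \<and> weighted_monotone (restrict w V) p"
      if v: "v \<in> leaves parent_graph" for v
    proof -
      obtain p where p: "vpath p ?T" "hd p = r" "last p = v" "weighted_monotone w p"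
        using monotone_path_from_root[of v] v by (auto simp: leaves_def)
      then have "set p \<subseteq> V" by (auto simp: vpath_def vwalk_def)
      with p show ?thesis by (auto simp: weighted_monotone_restrict)
    qed
    then show "\<exists>u\<in>pverts parent_graph. \<forall>v\<in>leaves parent_graph.
        \<exists>p. vpath p ?T \<and> hd p = u \<and> last p = v \<and> weighted_monotone (restrict w V) p"
      using root_in by auto
  qed
  with that subgraph graph_tree_parent_graph same_leaves show thesis by simp
qed

lemma star_convex_of_subgraph:
  assumes "weighted_graph G w" and sub: "subgraph (with_proj T) (with_proj G)"
    and "star_convex T (restrict w (pverts T))" and same: "leaves G = leaves T"
  shows "star_convex G w"
proof -
  obtain u where u: "u \<in> pverts T" and paths: "\<And>v. v \<in> leaves T \<Longrightarrow>
      \<exists>p. vpath p (with_proj T) \<and> hd p = u \<and> last p = v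
        \<and> weighted_monotone (restrict w (pverts T)) p"
    using assms(3) by (auto simp: star_convex_def)
  have "\<exists>p. vpath p (with_proj G) \<and> hd p = u \<and> last p = v \<and> weighted_monotone w p"
    if v: "v \<in> leaves G" for v
  proof -
    obtain p where p: "vpath p (with_proj T)" "hd p = u" "last p = v"
      "weighted_monotone (restrict w (pverts T)) p"
      using paths v same by auto
    from p(1) have "set p \<subseteq> pverts T" by (auto simp: vpath_def vwalk_def)
    with p(4) have "weighted_monotone w p" by (simp add: weighted_monotone_restrict)
    moreover have "vpath p (with_proj G)"
      using p(1) sub by (auto simp: vpath_def vwalk_def subgraph_def)
    ultimately show ?thesis using p by blast
  qed
  moreover have "u \<in> pverts G" using u sub by (auto simp: subgraph_def)
  moreover have "leaves G \<noteq> {}" using assms(3) same by (simp add: star_convex_def)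
  ultimately show ?thesis using assms(1) unfolding star_convex_def by blast
qed

theorem theorem1p6:
  fixes G :: "'a pair_pre_digraph" and w :: "'a \<Rightarrow> real"
  assumes "weighted_graph G w"
    and "2 \<le> card (leaves G)"
  shows "star_convex G w \<longleftrightarrow>
    (\<exists>T. subgraph (with_proj T) (with_proj G) \<and> graph_tree T \<and>
         star_convex T (restrict w (pverts T)) \<and> leaves G = leaves T)"
proof
  assume "star_convex G w"
  from star_convex_subtree_exists[OF this assms(2)]
  show "\<exists>T. subgraph (with_proj T) (with_proj G) \<and> graph_tree T \<and>
         star_convex T (restrict w (pverts T)) \<and> leaves G = leaves T"
    by blast
next
  assume "\<exists>T. subgraph (with_proj T) (with_proj G) \<and> graph_tree T \<and>
         star_convex T (restrict w (pverts T)) \<and> leaves G = leaves T"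
  then show "star_convex G w"
    using star_convex_of_subgraph[OF assms(1)] by blast
qed

end
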